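(* Let $\Lambda=\mathbb Z^3$ with height function $h(i)=-i_3$, $m=2$, $\varphi_1(x)=x(0,0,-1)\vee[x(0,1,-1)\wedge x(1,0,-1)]$, $\varphi_2(x)=x(0,0,-1)$, and for $r\in(0,1]$ let $\mathbf r(1)=r$, $\mathbf r(2)=1-r$. Write $\overline\rho(p,r)$ for the density $\overline\rho(p)$ of the maximal trajectory of the associated random monotone cellular automaton. Then: (i) $\lim_{p\to0}\overline\rho(p,r)=1$ for each $r\in(0,1]$; (ii) there exists a constant $c>0$ such that $\overline\rho(p,r)\to1$ whenever $r\to0$ and $p\to 0$ with $0\le p\le cr^2$; that is, for every $\epsilon>0$ there is $\delta>0$ such that $\overline\rho(p,r)\ge1-\epsilon$ for all $0<r<\delta$ and $0\le p\le cr^2$.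
   Context: Setting of random monotone cellular automata: $\Lambda$ a countable group (here $\mathbb Z^3$ with addition); a height function is a group homomorphism $h:\Lambda\to\mathbb Z$. $\varphi_0$ is the constant-zero map; $\varphi_1,\dots,\varphi_m$ are non-constant local monotone maps $\{0,1\}^\Lambda\to\{0,1\}$ depending only on coordinates in $\{i:h(i)=1\}$; $\mathbf r$ is a probability distribution on $\{1,\dots,m\}$; $(\mu(i))_{i\in\Lambda}$ i.i.d. with $\mathbb P[\mu(i)=0]=p$, $\mathbb P[\mu(i)=k]=(1-p)\mathbf r(k)$; $\Phi^p_i(x):=\varphi_{\mu(i)}((x(ij))_j)$. A trajectory is $x$ with $x(i)=\Phi^p_i(x)$ for all $i$; $\overline X^p$ is the maximal trajectory and $\overline\rho(p):=\mathbb P[\overline X^p(i)=1]$ (independent of $i$). *)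

theory Defs
  imports "HOL-Probability.Probability"
begin

type_synonym site = "int \<times> int \<times> int"

text \<open>Law of a single \<mu>(i): P[0] = p, P[1] = (1-p) r, P[2] = (1-p)(1-r).
  Value 0 stands for the constant-zero map, 1 for phi_1, 2 for phi_2.\<close>
definition mu_dist :: "real \<Rightarrow> real \<Rightarrow> nat pmf" where
  "mu_dist p r = bind_pmf (bernoulli_pmf p)
     (\<lambda>b. if b then return_pmf 0 else map_pmf (\<lambda>c. if c then 1 else 2) (bernoulli_pmf r))"

definition mu_field :: "real \<Rightarrow> real \<Rightarrow> (site \<Rightarrow> nat) measure" where
  "mu_field p r = PiM UNIV (\<lambda>_. measure_pmf (mu_dist p r))"

definition phi1 :: "(site \<Rightarrow> bool) \<Rightarrow> bool" where
  "phi1 x = (x (0,0,-1) \<or> (x (0,1,-1) \<and> x (1,0,-1)))"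

definition phi2 :: "(site \<Rightarrow> bool) \<Rightarrow> bool" where
  "phi2 x = x (0,0,-1)"

definition local_map :: "nat \<Rightarrow> (site \<Rightarrow> bool) \<Rightarrow> bool" where
  "local_map k x = (if k = 0 then False else if k = 1 then phi1 x else phi2 x)"

definition Phi :: "(site \<Rightarrow> nat) \<Rightarrow> (site \<Rightarrow> bool) \<Rightarrow> site \<Rightarrow> bool" where
  "Phi \<mu> x i = local_map (\<mu> i) (\<lambda>j. x (i + j))"

definition trajectory :: "(site \<Rightarrow> nat) \<Rightarrow> (site \<Rightarrow> bool) \<Rightarrow> bool" where
  "trajectory \<mu> x \<longleftrightarrow> (\<forall>i. x i = Phi \<mu> x i)"

definition max_traj :: "(site \<Rightarrow> nat) \<Rightarrow> site \<Rightarrow> bool" where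
  "max_traj \<mu> = gfp (Phi \<mu>)"

definition rho_bar :: "real \<Rightarrow> real \<Rightarrow> real" where
  "rho_bar p r = measure (mu_field p r) {\<mu>. max_traj \<mu> (0,0,0)}"

end

theory Submission
  imports Defs
begin

text \<open>
  Cut the time axis into blocks of length \<open>T\<close> and call the block at a space point \<^emph>\<open>bad\<close> if it
  contains a \<open>0\<close>-label or no \<open>1\<close>-label; this has probability at most \<open>T p + (1 - r) ^ T\<close>, which can
  be made small in both regimes of the theorem. If the trajectory is zero at the end of a good block,
  it is zero at the end of the preceding block, and one of the two neighbours is either zero at the end
  of its preceding block or has a bad block. Unfolding this binary branching until only bad blocks remain
  and listing them from left to right gives a chain of bad blocks (the Toom cycle of the zero).
  The function \<open>tilt\<close> decreases along the first kind of branch and increases along the second.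
  Hence it does not decrease from the first to the last element of the chain, whereas
  a jump of length \<open>l\<close> between consecutive elements raises it by at most \<open>4 - l / 2\<close>. So a chain of \<open>k\<close>
  elements has total length at most \<open>8 k\<close>. These properties survive cutting out loops, so the
  bad blocks may be taken distinct, hence independent, and a Peierls sum over chains finishes the proof.
\<close>

section \<open>Zeros of the maximal trajectory in finite time\<close>

text \<open>Along a decreasing sequence one late index witnesses the failure of several conditions
  at once. Continuity makes \<open>max_traj\<close> the infimum of the iterates from all ones, so
  every zero appears after finitely many steps.\<close>

lemma inf_continuous_Phi: "inf_continuous (Phi \<mu>)"
  unfolding inf_continuous_def
proof (intro allI impI)
  fix M :: "nat \<Rightarrow> site \<Rightarrow> bool"
  assume M: "decseq M"
  show "Phi \<mu> (INF n. M n) = (INF n. Phi \<mu> (M n))"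
  proof
    fix i
    have dec: "M n j" if "M m j" "n \<le> m" for n m j
      using le_funD[OF decseqD[OF M that(2)], of j] that(1) by simp
    have "(\<forall>n. M n a \<or> M n b \<and> M n c) \<longleftrightarrow> (\<forall>n. M n a) \<or> (\<forall>n. M n b) \<and> (\<forall>n. M n c)" for a b c
    proof -
      have "M n b \<and> M n c" if *: "\<forall>n. M n a \<or> M n b \<and> M n c" and m: "\<not> M m a" for n m
      proof -
        have "\<not> M (max n m) a" using m dec[of "max n m" a m] by auto
        with * have "M (max n m) b" "M (max n m) c" by blast+
        then show ?thesis using dec[of "max n m" _ n] by auto
      qed
      then show ?thesis by blast
    qed
    then show "Phi \<mu> (INF n. M n) i = (INF n. Phi \<mu> (M n)) i"
      by (auto simp: Phi_def local_map_def phi1_def phi2_def)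
  qed
qed

text \<open>\<open>zero_within \<mu> N i\<close>: site \<open>i\<close> is zero when the evolution is started from all ones \<open>N\<close> steps earlier.\<close>

definition zero_within :: "(site \<Rightarrow> nat) \<Rightarrow> nat \<Rightarrow> site \<Rightarrow> bool" where
  "zero_within \<mu> N i \<longleftrightarrow> \<not> (Phi \<mu> ^^ N) top i"

lemma not_max_traj_iff: "\<not> max_traj \<mu> i \<longleftrightarrow> (\<exists>N. zero_within \<mu> N i)"
  by (simp add: max_traj_def inf_continuous_gfp[OF inf_continuous_Phi] zero_within_def)

lemma zero_within_0 [simp]: "\<not> zero_within \<mu> 0 i"
  by (simp add: zero_within_def)

lemma zero_within_Suc:
  "zero_within \<mu> (Suc N) (a, b, t) \<longleftrightarrow> \<mu> (a, b, t) = 0 \<or>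
     zero_within \<mu> N (a, b, t - 1) \<and>
     (\<mu> (a, b, t) = 1 \<longrightarrow> zero_within \<mu> N (a, b + 1, t - 1) \<or> zero_within \<mu> N (a + 1, b, t - 1))"
  by (auto simp: zero_within_def Phi_def local_map_def phi1_def phi2_def)

text \<open>\<open>phi1\<close> and \<open>phi2\<close> hold whenever \<open>x (0,0,-1)\<close>
  does, so a zero under a nonzero label comes from a zero one time unit earlier. Nothing is zero
  within 0 steps, whence \<open>k \<le> N\<close>.\<close>

lemma zero_within_persists:
  assumes "zero_within \<mu> N (a, b, t)" "\<forall>s<k. \<mu> (a, b, t - int s) \<noteq> 0"
  shows "k \<le> N \<and> zero_within \<mu> (N - k) (a, b, t - int k)"
  using assms(2)
proof (induction k)
  case 0
  then show ?case using assms(1) by simp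
next
  case (Suc k)
  then have IH: "k \<le> N" "zero_within \<mu> (N - k) (a, b, t - int k)" and nz: "\<mu> (a, b, t - int k) \<noteq> 0"
    by auto
  then obtain m where m: "N - k = Suc m"
    by (metis not0_implies_Suc zero_within_0)
  then have "zero_within \<mu> m (a, b, t - int k - 1)"
    using IH nz by (simp add: zero_within_Suc)
  moreover have "N - Suc k = m" "Suc k \<le> N" using m by auto
  ultimately show ?case by (simp add: algebra_simps)
qed

section \<open>Chains of bad blocks\<close>

text \<open>Block \<open>(a, b, n)\<close> of length \<open>T\<close> consists of the sites \<open>(a, b, t)\<close> with \<open>(n - 1) T < t \<le> n T\<close>.\<close>

fun block_site :: "nat \<Rightarrow> site \<Rightarrow> nat \<Rightarrow> site" where
  "block_site T (a, b, n) s = (a, b, n * int T - int s)"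

definition bad_block :: "nat \<Rightarrow> (site \<Rightarrow> nat) \<Rightarrow> site \<Rightarrow> bool" where
  "bad_block T \<mu> v \<longleftrightarrow> (\<exists>s<T. \<mu> (block_site T v s) = 0) \<or> (\<forall>s<T. \<mu> (block_site T v s) \<noteq> 1)"

fun site_dist :: "site \<Rightarrow> site \<Rightarrow> int" where
  "site_dist (a, b, n) (a', b', n') = \<bar>a' - a\<bar> + \<bar>b' - b\<bar> + \<bar>n' - n\<bar>"

lemma site_dist_nonneg [simp]: "0 \<le> site_dist v w"
  by (cases v; cases w) simp

lemma site_dist_commute: "site_dist v w = site_dist w v"
  by (cases v; cases w) (simp add: abs_minus_commute)

lemma site_dist_triangle: "site_dist u w \<le> site_dist u v + site_dist v w"
proof -
  have "\<bar>z - x\<bar> \<le> \<bar>y - x\<bar> + \<bar>z - y\<bar>" for x y z :: int by linarith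
  then show ?thesis by (cases u; cases v; cases w) (force simp: add_mono algebra_simps)
qed

text \<open>Going down one level at a fixed space point changes it by -1 over distance 1. Passing to
  a neighbour changes it by +2 over distance 1 on the same level, and by +1 over distance 2 one
  level down.\<close>

fun tilt :: "site \<Rightarrow> int" where
  "tilt (a, b, n) = 2 * a + 2 * b + n"

definition linked :: "site \<Rightarrow> site \<Rightarrow> bool" where
  "linked v w \<longleftrightarrow> site_dist v w + 2 * tilt w - 2 * tilt v \<le> 8"

text \<open>\<open>p\<close> and \<open>q\<close> stand for the roots of two subtrees,
  \<open>v\<close> for the last leaf under \<open>p\<close>, \<open>w\<close> for the first under
  \<open>q\<close>. On the detour via \<open>p\<close> and \<open>q\<close> the tilt of
  \<open>v\<close> cancels, and \<open>tilt w \<le> tilt q\<close> absorbs the rest.\<close>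

lemma linked_via:
  assumes "site_dist p v \<le> 2 * tilt v - 2 * tilt p" "site_dist q w \<le> tilt q - tilt w"
    and "site_dist p q + 2 * tilt q - 2 * tilt p \<le> 8"
  shows "linked v w"
proof -
  have "site_dist v w \<le> site_dist p v + site_dist p q + site_dist q w"
    using site_dist_triangle[of v w p] site_dist_triangle[of p w q] site_dist_commute[of v p]
    by linarith
  then show ?thesis
    using assms site_dist_nonneg[of q w] unfolding linked_def by linarith
qed

text \<open>A zero runs down a column free of label 0. Where it meets a label 1, it forces a zero at
  a neighbour one time unit earlier, which runs down in the same way unless that block is
  bad.\<close>

lemma good_block_zero:
  assumes zero: "zero_within \<mu> N (a, b, n * int T)" and good: "\<not> bad_block T \<mu> (a, b, n)" and "T > 0"
  obtains a' b' N' where "N' < N" "zero_within \<mu> N' (a, b, (n - 1) * int T)"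
    "(a', b') \<in> {(a, b + 1), (a + 1, b)}"
    "bad_block T \<mu> (a', b', n) \<or> zero_within \<mu> N' (a', b', (n - 1) * int T)"
proof -
  have nz: "\<forall>s<T. \<mu> (a, b, n * int T - int s) \<noteq> 0"
    using good by (auto simp: bad_block_def)
  obtain s where s: "s < T" "\<mu> (a, b, n * int T - int s) = 1"
    using good by (auto simp: bad_block_def)
  have T: "T \<le> N" "zero_within \<mu> (N - T) (a, b, (n - 1) * int T)"
    using zero_within_persists[OF zero nz] by (auto simp: algebra_simps)
  have "zero_within \<mu> (N - s) (a, b, n * int T - int s)"
    using zero_within_persists[OF zero, of s] nz s by auto
  moreover have "N - s = Suc (N - s - 1)" using s T by simp
  ultimately obtain a' b' where ab: "(a', b') \<in> {(a, b + 1), (a + 1, b)}"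
    and z: "zero_within \<mu> (N - s - 1) (a', b', n * int T - int s - 1)"
    using s(2) zero_within_Suc[of \<mu> "N - s - 1" a b "n * int T - int s"] by auto
  have "zero_within \<mu> (N - T) (a', b', (n - 1) * int T)" if "\<not> bad_block T \<mu> (a', b', n)"
  proof -
    have "\<forall>q<T. \<mu> (a', b', n * int T - int q) \<noteq> 0"
      using that by (auto simp: bad_block_def)
    \<comment> \<open>The neighbour's zero sits at offset \<open>s + 1\<close>, so
      \<open>T - s - 1\<close> labels of its block remain; for \<open>s = T - 1\<close> there are
      none.\<close>
    then have "\<mu> (a', b', n * int T - int s - 1 - int q) \<noteq> 0" if "q < T - s - 1" for q
      using that by (auto dest!: spec[of _ "s + 1 + q"] simp: algebra_simps)
    then have "zero_within \<mu> (N - s - 1 - (T - s - 1)) (a', b', n * int T - int s - 1 - int (T - s - 1))"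
      using zero_within_persists[OF z, of "T - s - 1"] by blast
    moreover have "N - s - 1 - (T - s - 1) = N - T"
      "n * int T - int s - 1 - int (T - s - 1) = (n - 1) * int T"
      using s T by (auto simp: algebra_simps)
    ultimately show ?thesis by simp
  qed
  then show ?thesis
    using that[of "N - T" a' b'] T ab \<open>T > 0\<close> by auto
qed

text \<open>The first leaf is reached by branches of the first kind only, the last by branches of
  the second kind only. The two distance bounds record this; the induction needs both to link the
  chains of the two subtrees.\<close>

lemma zero_chain:
  assumes "T > 0" "zero_within \<mu> N (a, b, n * int T)"
  shows "\<exists>ws. ws \<noteq> [] \<and> (\<forall>w\<in>set ws. bad_block T \<mu> w) \<and> successively linked ws \<and>
    site_dist (a, b, n) (hd ws) \<le> tilt (a, b, n) - tilt (hd ws) \<and>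
    site_dist (a, b, n) (last ws) \<le> 2 * tilt (last ws) - 2 * tilt (a, b, n)"
  using assms(2)
proof (induction N arbitrary: a b n rule: less_induct)
  case (less N)
  show ?case
  proof (cases "bad_block T \<mu> (a, b, n)")
    case True
    then show ?thesis by (intro exI[of _ "[(a, b, n)]"]) simp
  next
    case False
    obtain a' b' N' where N': "N' < N" "zero_within \<mu> N' (a, b, (n - 1) * int T)"
      and ab: "(a', b') \<in> {(a, b + 1), (a + 1, b)}"
      and nb: "bad_block T \<mu> (a', b', n) \<or> zero_within \<mu> N' (a', b', (n - 1) * int T)"
      using good_block_zero[OF less.prems False \<open>T > 0\<close>] .
    obtain us where us: "us \<noteq> []" "\<forall>w\<in>set us. bad_block T \<mu> w" "successively linked us"
      "site_dist (a, b, n - 1) (hd us) \<le> tilt (a, b, n - 1) - tilt (hd us)"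
      "site_dist (a, b, n - 1) (last us) \<le> 2 * tilt (last us) - 2 * tilt (a, b, n - 1)"
      using less.IH[OF N'] by blast
    obtain n' vs where n': "n' = n \<or> n' = n - 1"
      and vs: "vs \<noteq> []" "\<forall>w\<in>set vs. bad_block T \<mu> w" "successively linked vs"
      "site_dist (a', b', n') (hd vs) \<le> tilt (a', b', n') - tilt (hd vs)"
      "site_dist (a', b', n') (last vs) \<le> 2 * tilt (last vs) - 2 * tilt (a', b', n')"
    proof (cases "bad_block T \<mu> (a', b', n)")
      case True
      then show ?thesis using that[of n "[(a', b', n)]"] by simp
    next
      case False
      with nb have "zero_within \<mu> N' (a', b', (n - 1) * int T)" by blast
      from less.IH[OF N'(1) this] show ?thesis using that[of "n - 1"] by blast
    qed
    let ?p = "(a, b, n - 1)" and ?q = "(a', b', n')"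
    \<comment> \<open>The constant 8 in \<open>linked\<close> comes from \<open>n' = n\<close>:
      distance 2 and tilt gain 3 give 2 + 6. For \<open>n' = n - 1\<close> the value is 1 +
      4.\<close>
    have pq: "site_dist ?p ?q + 2 * tilt ?q - 2 * tilt ?p \<le> 8"
      "site_dist (a, b, n) ?q \<le> 2 * tilt ?q - 2 * tilt (a, b, n)"
      "site_dist (a, b, n) ?p = 1" "tilt (a, b, n) = tilt ?p + 1"
      using ab n' by auto
    have "linked (last us) (hd vs)"
      using linked_via[OF us(5) vs(4) pq(1)] .
    then have "successively linked (us @ vs)"
      using us vs by (simp add: successively_append_iff)
    moreover have "site_dist (a, b, n) (hd us) \<le> tilt (a, b, n) - tilt (hd us)"
      using us(4) pq(3,4) site_dist_triangle[of "(a, b, n)" "hd us" ?p] by linarith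
    moreover have "site_dist (a, b, n) (last vs) \<le> 2 * tilt (last vs) - 2 * tilt (a, b, n)"
      using vs(5) pq(2) site_dist_triangle[of "(a, b, n)" "last vs" ?q] by linarith
    ultimately show ?thesis
      using us(1,2) vs(1,2) by (intro exI[of _ "us @ vs"]) auto
  qed
qed

text \<open>Cutting from one occurrence of an entry to another creates no new consecutive pair and
  keeps both ends.\<close>

lemma successively_distinct_subpath:
  assumes "successively R ws" "ws \<noteq> []"
  shows "\<exists>vs. vs \<noteq> [] \<and> distinct vs \<and> successively R vs \<and> set vs \<subseteq> set ws \<and>
    hd vs = hd ws \<and> last vs = last ws"
  using assms
proof (induction "length ws" arbitrary: ws rule: less_induct)
  case less
  show ?case
  proof (cases "distinct ws")
    case True
    then show ?thesis using less.prems by blast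
  next
    case False
    then obtain xs ys zs y where ws: "ws = xs @ [y] @ ys @ [y] @ zs"
      using not_distinct_decomp by blast
    let ?us = "xs @ [y] @ zs"
    have "successively R ?us"
      using less.prems(1) by (auto simp: ws successively_append_iff successively_Cons)
    with less.hyps[of ?us] obtain vs where "vs \<noteq> []" "distinct vs" "successively R vs"
      "set vs \<subseteq> set ?us" "hd vs = hd ?us" "last vs = last ?us"
      by (auto simp: ws)
    then show ?thesis
      by (intro exI[of _ vs]) (auto simp: ws hd_append)
  qed
qed

fun path_length :: "site \<Rightarrow> site list \<Rightarrow> int" where
  "path_length v [] = 0"
| "path_length v (w # ws) = site_dist v w + path_length w ws"

text \<open>Summing the link inequalities telescopes the tilt.\<close>

lemma path_length_linked:
  assumes "successively linked (w # ws)"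
  shows "path_length w ws + 2 * tilt (last (w # ws)) - 2 * tilt w \<le> 8 * int (length ws)"
  using assms
proof (induction ws arbitrary: w)
  case (Cons u us)
  then have "linked w u" "successively linked (u # us)" by auto
  with Cons.IH[of u] show ?case
    unfolding linked_def path_length.simps by simp
qed simp

lemma path_length_nonneg [simp]: "0 \<le> path_length v ws"
  by (induction ws arbitrary: v) auto

text \<open>The first element has tilt at most minus its distance from the origin, the last has
  nonnegative tilt. The telescoped difference thus pays for the jump from the origin to the
  chain.\<close>

lemma zero_bad_chain:
  assumes "T > 0" "\<not> max_traj \<mu> (0, 0, 0)"
  obtains ws where "ws \<noteq> []" "distinct ws" "\<forall>w\<in>set ws. bad_block T \<mu> w"
    "path_length (0, 0, 0) ws \<le> 8 * int (length ws)"
proof -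
  obtain N where "zero_within \<mu> N (0, 0, 0 * int T)"
    using assms(2) by (auto simp: not_max_traj_iff)
  from zero_chain[OF \<open>T > 0\<close> this] obtain us where us: "us \<noteq> []" "\<forall>w\<in>set us. bad_block T \<mu> w"
    "successively linked us" "site_dist (0, 0, 0) (hd us) \<le> - tilt (hd us)"
    "site_dist (0, 0, 0) (last us) \<le> 2 * tilt (last us)"
    by auto
  obtain ws where ws: "ws \<noteq> []" "distinct ws" "successively linked ws" "set ws \<subseteq> set us"
    "hd ws = hd us" "last ws = last us"
    using successively_distinct_subpath[OF us(3,1)] by blast
  obtain w vs where w: "ws = w # vs" using ws(1) by (cases ws) auto
  have "path_length w vs + 2 * tilt (last ws) - 2 * tilt w \<le> 8 * int (length vs)"
    using path_length_linked ws(3) unfolding w .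
  moreover have "0 \<le> tilt (last ws)"
    using us(5) site_dist_nonneg[of "(0, 0, 0)" "last us"] unfolding ws(6) by linarith
  moreover have "site_dist (0, 0, 0) w \<le> - tilt w"
    using us(4) ws(5) by (simp add: w)
  ultimately have "path_length (0, 0, 0) ws \<le> 8 * int (length ws)"
    using site_dist_nonneg[of "(0, 0, 0)" w] unfolding w path_length.simps length_Cons of_nat_Suc distrib_left by linarith
  with ws us(2) show ?thesis using that by blast
qed

section \<open>Counting short paths\<close>

text \<open>Giving a path of length \<open>l\<close> the weight \<open>2 ^ (- l)\<close> makes the weights of all paths with \<open>k\<close> steps
  sum up to \<open>27 ^ k\<close>, because \<open>\<Sum>j\<in>\<int>. 2 ^ (- \<bar>j\<bar>) = 3\<close>.\<close>

lemma sum_half_power_abs: "(\<Sum>j\<in>{- int n..int n}. (1/2::real) ^ nat \<bar>j\<bar>) = 3 - 2 * (1/2) ^ n"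
proof (induction n)
  case (Suc n)
  have "{- int (Suc n)..int (Suc n)} = insert (int (Suc n)) (insert (- int (Suc n)) {- int n..int n})"
    by auto
  then show ?case using Suc by (simp add: nat_add_distrib)
qed simp

lemma site_ball_subset_box:
  fixes v :: site and n :: nat
  defines "S \<equiv> {- int n..int n}"
  shows "{w. site_dist v w \<le> int n} \<subseteq> (+) v ` (S \<times> S \<times> S)"
proof
  fix w assume "w \<in> {w. site_dist v w \<le> int n}"
  then have "w - v \<in> S \<times> S \<times> S" unfolding S_def by (cases v; cases w) auto
  then show "w \<in> (+) v ` (S \<times> S \<times> S)" by (intro image_eqI[of _ _ "w - v"]) auto
qed

lemma finite_site_ball: "finite {w. site_dist v w \<le> int n}"
  by (rule finite_subset[OF site_ball_subset_box]) auto

text \<open>Over the enclosing box the sum factorises into three one-dimensional sums, each at most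
  3.\<close>

lemma sum_half_power_site_dist:
  "(\<Sum>w | site_dist v w \<le> int n. (1/2::real) ^ nat (site_dist v w)) \<le> 27"
proof -
  define S where "S = {- int n..int n}"
  define f :: "int \<Rightarrow> real" where "f j = (1/2) ^ nat \<bar>j\<bar>" for j
  have f: "(1/2) ^ nat (site_dist v (v + (x, y, z))) = f x * (f y * f z)" for x y z
    by (cases v) (simp add: f_def nat_add_distrib power_add)
  have "(\<Sum>w | site_dist v w \<le> int n. (1/2::real) ^ nat (site_dist v w))
      \<le> (\<Sum>w\<in>(+) v ` (S \<times> S \<times> S). (1/2) ^ nat (site_dist v w))"
    using site_ball_subset_box[of v n] by (intro sum_mono2) (auto simp: S_def)
  also have "\<dots> = (\<Sum>(x, y, z)\<in>S \<times> S \<times> S. f x * (f y * f z))"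
    by (subst sum.reindex) (auto intro!: sum.cong simp: f inj_on_def)
  also have "\<dots> = (\<Sum>x\<in>S. f x * (\<Sum>y\<in>S. f y * sum f S))"
    by (simp add: sum.cartesian_product' sum_distrib_left)
  also have "\<dots> = sum f S * (sum f S * sum f S)"
    by (simp only: sum_distrib_right)
  also have "\<dots> \<le> 3 * (3 * 3)"
  proof -
    have "0 \<le> sum f S" by (auto simp: f_def intro!: sum_nonneg)
    moreover have "sum f S \<le> 3" using sum_half_power_abs[of n] by (simp add: S_def f_def)
    ultimately show ?thesis by (intro mult_mono) auto
  qed
  finally show ?thesis by simp
qed

text \<open>A first jump of length \<open>d\<close> leaves the budget \<open>n - d\<close>, and
  \<open>2 ^ (n - d)\<close> summed over first jumps is at most \<open>27 * 2 ^ n\<close>.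
  Finiteness is carried along because an infinite set has \<open>card\<close> 0.\<close>

lemma card_short_paths:
  "finite {ws. length ws = k \<and> path_length v ws \<le> int n} \<and>
   real (card {ws. length ws = k \<and> path_length v ws \<le> int n}) \<le> 27 ^ k * 2 ^ n"
proof (induction k arbitrary: v n)
  case 0
  have "{ws. length ws = 0 \<and> path_length v ws \<le> int n} = {[]}" by auto
  then show ?case by (simp del: length_0_conv)
next
  case (Suc k)
  define P where "P w m = {ws. length ws = k \<and> path_length w ws \<le> int m}" for w m
  define B where "B = {w. site_dist v w \<le> int n}"
  define d where "d w = nat (site_dist v w)" for w
  have B: "finite B" unfolding B_def by (rule finite_site_ball)
  have P: "finite (P w m)" "real (card (P w m)) \<le> 27 ^ k * 2 ^ m" for w m
    using Suc.IH unfolding P_def by auto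
  have dn: "d w \<le> n" if "w \<in> B" for w
    using that by (auto simp: B_def d_def)
  have eq: "{ws. length ws = Suc k \<and> path_length v ws \<le> int n} = (\<Union>w\<in>B. (#) w ` P w (n - d w))"
    (is "?L = ?R")
  proof
    show "?L \<subseteq> ?R"
    proof
      fix us assume "us \<in> ?L"
      then obtain w ws where ws: "us = w # ws" "length ws = k" "site_dist v w + path_length w ws \<le> int n"
        by (cases us) auto
      moreover have "w \<in> B" using ws(3) path_length_nonneg[of w ws] unfolding B_def
        by (simp del: path_length_nonneg)
      moreover from this have "int (n - d w) = int n - site_dist v w"
        using dn by (simp add: d_def of_nat_diff)
      ultimately have "w \<in> B" "us \<in> (#) w ` P w (n - d w)" by (auto simp: P_def)
      then show "us \<in> ?R" by blast
    qed
    show "?R \<subseteq> ?L" using dn by (auto simp: P_def d_def of_nat_diff)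
  qed
  have "real (card ?R) \<le> (\<Sum>w\<in>B. real (card ((#) w ` P w (n - d w))))"
    using card_UN_le[OF B] unfolding of_nat_sum[symmetric] of_nat_le_iff by blast
  also have "\<dots> \<le> (\<Sum>w\<in>B. 27 ^ k * 2 ^ (n - d w))"
    using P by (intro sum_mono) (simp add: card_image)
  also have "\<dots> = 27 ^ k * 2 ^ n * (\<Sum>w\<in>B. (1/2) ^ nat (site_dist v w))"
    using dn by (auto simp: sum_distrib_left power_diff power_one_over d_def[symmetric] intro!: sum.cong)
  also have "\<dots> \<le> 27 ^ k * 2 ^ n * 27"
    unfolding B_def by (intro mult_left_mono sum_half_power_site_dist) auto
  finally show ?case unfolding eq using B P by auto
qed

section \<open>Random labels and independence of blocks\<close>

lemma prob_space_mu_field: "prob_space (mu_field p r)"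
  unfolding mu_field_def by (intro prob_space_PiM measure_pmf.prob_space_axioms)

lemma space_mu_field [simp]: "space (mu_field p r) = UNIV"
  by (simp add: mu_field_def space_PiM)

lemma measurable_mu_coordinate [measurable]: "(\<lambda>\<mu>. \<mu> i) \<in> mu_field p r \<rightarrow>\<^sub>M count_space UNIV"
  unfolding mu_field_def using measurable_component_singleton[of i UNIV "\<lambda>_. measure_pmf (mu_dist p r)"]
  by simp

lemma measurable_zero_within [measurable]: "Measurable.pred (mu_field p r) (\<lambda>\<mu>. zero_within \<mu> N i)"
proof (induction N arbitrary: i)
  case (Suc N)
  note [measurable] = Suc
  show ?case by (cases i) (simp add: zero_within_Suc)
qed simp

lemma measurable_max_traj [measurable]: "Measurable.pred (mu_field p r) (\<lambda>\<mu>. max_traj \<mu> i)"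
proof -
  have "max_traj \<mu> i \<longleftrightarrow> (\<forall>N. \<not> zero_within \<mu> N i)" for \<mu>
    using not_max_traj_iff by blast
  then show ?thesis by simp
qed

lemma measurable_bad_block [measurable]: "Measurable.pred (mu_field p r) (\<lambda>\<mu>. bad_block T \<mu> v)"
  unfolding bad_block_def by measurable

lemma mu_dist_zero:
  assumes "p \<in> {0..1}"
  shows "measure (mu_dist p r) {0} = p"
proof -
  have "(\<lambda>c. if c then 1 else 2) -` {0::nat} = {}" by (auto split: if_splits)
  then show ?thesis
    using assms by (simp add: mu_dist_def measure_pmf_single pmf_bind pmf_map)
qed

lemma mu_dist_neither:
  assumes "p \<in> {0..1}" "r \<in> {0..1}"
  shows "measure (mu_dist p r) (- {0, 1}) \<le> 1 - r"
proof -
  have "set_pmf (mu_dist p r) \<subseteq> {0, 1, 2}"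
    by (auto simp: mu_dist_def split: if_splits)
  then have "measure (mu_dist p r) (- {0, 1}) = measure (mu_dist p r) {2}"
    by (intro measure_prob_cong_0) (auto simp: pmf_eq_0_set_pmf)
  moreover have "(\<lambda>c. if c then 1 else 2) -` {2::nat} = {False}" by auto
  then have "measure (mu_dist p r) {2} = (1 - p) * (1 - r)"
    using assms by (simp add: mu_dist_def measure_pmf_single pmf_bind pmf_map)
  ultimately show ?thesis using assms by (simp add: mult_left_le_one_le)
qed

lemma indep_mu_coordinates:
  "prob_space.indep_vars (mu_field p r) (\<lambda>_. measure_pmf (mu_dist p r)) (\<lambda>i \<mu>. \<mu> i) UNIV"
proof -
  interpret product_prob_space "\<lambda>_. measure_pmf (mu_dist p r)" "UNIV :: site set"
    by unfold_locales
  have "distr (PiM UNIV (\<lambda>_. measure_pmf (mu_dist p r))) (PiM UNIV (\<lambda>_. measure_pmf (mu_dist p r)))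
      (\<lambda>\<mu>. \<lambda>i\<in>(UNIV::site set). \<mu> i) = PiM UNIV (\<lambda>_. measure_pmf (mu_dist p r))"
    by (simp add: restrict_def distr_id2)
  then show ?thesis
    unfolding mu_field_def by (subst indep_vars_iff_distr_eq_PiM) (auto simp: PiM_component intro: measurable_mu_coordinate[unfolded mu_field_def])
qed

text \<open>Offsets below \<open>T\<close> differ by less than \<open>T\<close>. So distinct blocks
  share no site, and a block has exactly \<open>T\<close> sites.\<close>

lemma block_site_eq_iff:
  assumes "s < T" "s' < T"
  shows "block_site T v s = block_site T v' s' \<longleftrightarrow> v = v' \<and> s = s'"
proof -
  have "n = n' \<and> s = s'" if "n * int T - int s = n' * int T - int s'" for n n' :: int
  proof -
    have "\<bar>(n - n') * int T\<bar> < int T"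
      using that assms by (auto simp: algebra_simps)
    then have "n = n'" using assms by (auto simp: abs_mult)
    then show ?thesis using that by simp
  qed
  then show ?thesis by (cases v; cases v') auto
qed

text \<open>Distinct blocks depend on disjoint sets of coordinates.\<close>

lemma prob_bad_blocks:
  assumes "finite S" "S \<noteq> {}"
  shows "measure (mu_field p r) {\<mu>. \<forall>v\<in>S. bad_block T \<mu> v} =
    (\<Prod>v\<in>S. measure (mu_field p r) {\<mu>. bad_block T \<mu> v})"
proof -
  interpret prob_space "mu_field p r" by (rule prob_space_mu_field)
  define K where "K v = block_site T v ` {..<T}" for v
  have "disjoint_family_on K UNIV"
    unfolding disjoint_family_on_def K_def using block_site_eq_iff[of _ T] by blast
  then have indep: "indep_vars (\<lambda>v. PiM (K v) (\<lambda>_. measure_pmf (mu_dist p r))) (\<lambda>v \<mu>. restrict \<mu> (K v)) UNIV"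
    using indep_vars_restrict[OF indep_mu_coordinates, of UNIV K] by simp
  have "Measurable.pred (PiM (K v) (\<lambda>_. measure_pmf (mu_dist p r))) (\<lambda>x. bad_block T x v)" for v
  proof -
    have [measurable]: "(\<lambda>x. x (block_site T v s)) \<in> PiM (K v) (\<lambda>_. measure_pmf (mu_dist p r)) \<rightarrow>\<^sub>M count_space UNIV"
      if "s \<in> {..<T}" for s
      using measurable_component_singleton[of "block_site T v s" "K v" "\<lambda>_. measure_pmf (mu_dist p r)"] that
      by (simp add: K_def)
    \<comment> \<open>Only offsets below \<open>T\<close> are read and their sites lie in
      \<open>K v\<close>, so the event lives on the coordinates of this block.\<close>
    have "bad_block T x v \<longleftrightarrow> (\<exists>s\<in>{..<T}. x (block_site T v s) = 0) \<or> (\<forall>s\<in>{..<T}. x (block_site T v s) \<noteq> 1)" for x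
      by (auto simp: bad_block_def)
    then show ?thesis by simp
  qed
  then have "indep_events (\<lambda>v. {\<mu> \<in> space (mu_field p r). bad_block T (restrict \<mu> (K v)) v}) UNIV"
    by (intro indep_eventsI_indep_vars[OF indep, of "\<lambda>v x. bad_block T x v"]) (simp add: pred_def)
  moreover have "bad_block T (restrict \<mu> (K v)) v = bad_block T \<mu> v" for \<mu> v
    by (auto simp: bad_block_def K_def)
  ultimately have "prob (\<Inter>v\<in>S. {\<mu>. bad_block T \<mu> v}) = (\<Prod>v\<in>S. prob {\<mu>. bad_block T \<mu> v})"
    using assms unfolding indep_events_def by simp
  moreover have "(\<Inter>v\<in>S. {\<mu>. bad_block T \<mu> v}) = {\<mu>. \<forall>v\<in>S. bad_block T \<mu> v}" by auto
  ultimately show ?thesis by simp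
qed

lemma prob_bad_block_le:
  assumes "p \<in> {0..1}" "r \<in> {0..1}"
  shows "measure (mu_field p r) {\<mu>. bad_block T \<mu> v} \<le> real T * p + (1 - r) ^ T"
proof -
  interpret prob_space "mu_field p r" by (rule prob_space_mu_field)
  interpret P: product_prob_space "\<lambda>_. measure_pmf (mu_dist p r)" "UNIV :: site set"
    by unfold_locales
  have PiM: "prob {\<mu>. \<forall>i\<in>J. \<mu> i \<in> A} = measure (mu_dist p r) A ^ card J" if "finite J" for J :: "site set" and A
  proof -
    have "prod_emb UNIV (\<lambda>_. measure_pmf (mu_dist p r)) J (PiE J (\<lambda>_. A)) = {\<mu>. \<forall>i\<in>J. \<mu> i \<in> A}"
      by (auto simp: prod_emb_def)
    then show ?thesis
      using P.measure_PiM_emb[of J "\<lambda>_. A"] that by (simp add: mu_field_def)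
  qed
  define Z where "Z s = {\<mu> :: site \<Rightarrow> nat. \<mu> (block_site T v s) = 0}" for s
  \<comment> \<open>Label 0 is already covered by \<open>Z\<close>; excluding it here gives the
    bound \<open>1 - r\<close> per site instead of \<open>1 - (1 - p) * r\<close>.\<close>
  define W where "W = {\<mu> :: site \<Rightarrow> nat. \<forall>i\<in>block_site T v ` {..<T}. \<mu> i \<in> - {0, 1}}"
  have [measurable]: "Z s \<in> events" "W \<in> events" for s
  proof -
    have "{\<mu> \<in> space (mu_field p r). \<mu> (block_site T v s) = 0} \<in> events"
      "{\<mu> \<in> space (mu_field p r). \<forall>i\<in>block_site T v ` {..<T}. \<not> (\<mu> i = 0 \<or> \<mu> i = 1)} \<in> events"
      by measurable
    then show "Z s \<in> events" "W \<in> events" by (simp_all add: Z_def W_def)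
  qed
  have Z: "prob (Z s) = p" for s
    using PiM[of "{block_site T v s}" "{0}"] mu_dist_zero[OF assms(1)] by (simp add: Z_def)
  have "card (block_site T v ` {..<T}) = T"
    by (subst card_image) (auto simp: inj_on_def block_site_eq_iff simp del: block_site.simps)
  then have W: "prob W \<le> (1 - r) ^ T"
    using PiM[of "block_site T v ` {..<T}" "- {0, 1}"] mu_dist_neither[OF assms]
    by (simp add: W_def power_mono)
  have "prob {\<mu>. bad_block T \<mu> v} \<le> prob ((\<Union>s<T. Z s) \<union> W)"
  proof (intro finite_measure_mono)
    show "{\<mu>. bad_block T \<mu> v} \<subseteq> (\<Union>s<T. Z s) \<union> W"
      by (auto simp: bad_block_def Z_def W_def)
  qed measurable
  also have "\<dots> \<le> prob (\<Union>s<T. Z s) + prob W"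
    by (intro measure_Un_le) auto
  also have "prob (\<Union>s<T. Z s) \<le> (\<Sum>s<T. prob (Z s))"
    by (intro finite_measure_subadditive_finite) auto
  finally show ?thesis using Z W by simp
qed

section \<open>Peierls sum and the two limits\<close>

text \<open>There are at most \<open>27 ^ k * 2 ^ (8 * k)\<close> possible chains of
  \<open>k\<close> distinct bad blocks, and \<open>6912 = 27 * 2 ^ 8\<close>.\<close>

lemma rho_bar_ge:
  assumes "p \<in> {0..1}" "r \<in> {0..1}" "T > 0"
    and x: "6912 * (real T * p + (1 - r) ^ T) \<le> x" "x < 1"
  shows "rho_bar p r \<ge> 1 - x / (1 - x)"
proof -
  interpret prob_space "mu_field p r" by (rule prob_space_mu_field)
  define W where "W k = {ws. length ws = k \<and> path_length (0, 0, 0) ws \<le> int (8 * k)}" for k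
  define V where "V k = {ws \<in> W k. distinct ws}" for k
  \<comment> \<open>Chains are nonempty, so the union runs over lengths \<open>Suc k\<close> and the
    geometric series starts at \<open>x\<close>.\<close>
  define E where "E k = (\<Union>ws\<in>V (Suc k). {\<mu>. \<forall>w\<in>set ws. bad_block T \<mu> w})" for k
  have "finite (W k)" for k
    using card_short_paths[of k "(0, 0, 0)" "8 * k"] unfolding W_def by blast
  then have fin: "finite (V k)" for k unfolding V_def by simp
  have bad_event: "{\<mu>. \<forall>w\<in>S. bad_block T \<mu> w} \<in> events" if "finite S" for S
  proof -
    have "{\<mu> \<in> space (mu_field p r). \<forall>w\<in>S. bad_block T \<mu> w} \<in> events"
      using that by measurable
    then show ?thesis by simp
  qed
  have E_event: "E k \<in> events" for k
    unfolding E_def using fin bad_event by (intro sets.finite_UN) auto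
  define \<eta> where "\<eta> = real T * p + (1 - r) ^ T"
  have \<eta>: "0 \<le> \<eta>" using assms by (simp add: \<eta>_def)
  then have x0: "0 \<le> x" using x(1) by (simp add: \<eta>_def[symmetric])
  have E: "prob (E k) \<le> x ^ Suc k" for k
  proof -
    have "prob {\<mu>. \<forall>w\<in>set ws. bad_block T \<mu> w} \<le> \<eta> ^ Suc k" if "ws \<in> V (Suc k)" for ws
    proof -
      have "card (set ws) = Suc k" "set ws \<noteq> {}"
        using that by (auto simp: V_def W_def distinct_card)
      moreover have "(\<Prod>v\<in>set ws. prob {\<mu>. bad_block T \<mu> v}) \<le> (\<Prod>v\<in>set ws. \<eta>)"
        using prob_bad_block_le[OF assms(1,2)] by (intro prod_mono) (auto simp: \<eta>_def)
      ultimately show ?thesis by (simp add: prob_bad_blocks)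
    qed
    then have "prob (E k) \<le> (\<Sum>ws\<in>V (Suc k). \<eta> ^ Suc k)"
      unfolding E_def using fin bad_event
      by (intro order.trans[OF finite_measure_subadditive_finite] sum_mono) auto
    also have "\<dots> = real (card (V (Suc k))) * \<eta> ^ Suc k" by simp
    also have "real (card (V (Suc k))) \<le> 27 ^ Suc k * 2 ^ (8 * Suc k)"
    proof -
      have "card (V (Suc k)) \<le> card (W (Suc k))"
        using card_short_paths[of "Suc k" "(0, 0, 0)" "8 * Suc k"] unfolding V_def W_def
        by (intro card_mono) auto
      then show ?thesis
        using card_short_paths[of "Suc k" "(0, 0, 0)" "8 * Suc k"] unfolding W_def by linarith
    qed
    also have "27 ^ Suc k * 2 ^ (8 * Suc k) * \<eta> ^ Suc k = (6912 * \<eta>) ^ Suc k"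
      unfolding power_mult power_mult_distrib[symmetric] by simp
    also have "\<dots> \<le> x ^ Suc k"
      using x(1) \<eta> by (intro power_mono) (auto simp: \<eta>_def)
    finally show ?thesis using \<eta> by (simp add: mult_right_mono)
  qed
  have geo: "(\<lambda>k. x ^ Suc k) sums (x / (1 - x))"
    using sums_mult[OF geometric_sums[of x], of x] x(2) x0 by simp
  have sE: "summable (\<lambda>k. prob (E k))"
    by (rule summable_comparison_test[OF _ sums_summable[OF geo]]) (use E in auto)
  have "{\<mu>. \<not> max_traj \<mu> (0, 0, 0)} \<subseteq> (\<Union>k. E k)"
  proof
    fix \<mu> assume "\<mu> \<in> {\<mu>. \<not> max_traj \<mu> (0, 0, 0)}"
    then obtain ws where ws: "ws \<noteq> []" "distinct ws" "\<forall>w\<in>set ws. bad_block T \<mu> w"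
      "path_length (0, 0, 0) ws \<le> 8 * int (length ws)"
      using zero_bad_chain[OF \<open>T > 0\<close>, of \<mu>] by auto
    then have "ws \<in> V (Suc (length ws - 1))"
      by (simp add: V_def W_def)
    with ws(3) have "\<mu> \<in> E (length ws - 1)" unfolding E_def by blast
    then show "\<mu> \<in> (\<Union>k. E k)" by blast
  qed
  then have "prob {\<mu>. \<not> max_traj \<mu> (0, 0, 0)} \<le> prob (\<Union>k. E k)"
    using E_event by (intro finite_measure_mono) auto
  also have "\<dots> \<le> (\<Sum>k. prob (E k))"
    using E_event sE by (intro finite_measure_subadditive_countably) auto
  also have "\<dots> \<le> (\<Sum>k. x ^ Suc k)"
    using E sE sums_summable[OF geo] by (intro suminf_le) auto
  also have "\<dots> = x / (1 - x)"
    using geo by (rule sums_unique[symmetric])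
  finally have "prob {\<mu>. \<not> max_traj \<mu> (0, 0, 0)} \<le> x / (1 - x)" .
  moreover have "prob {\<mu> \<in> space (mu_field p r). \<not> max_traj \<mu> (0, 0, 0)}
      = 1 - prob {\<mu> \<in> space (mu_field p r). max_traj \<mu> (0, 0, 0)}"
    by (intro prob_neg) measurable
  ultimately show ?thesis by (simp add: rho_bar_def)
qed

text \<open>The block length stays free: each regime only has to choose \<open>T\<close> so that
  both terms are small.\<close>

lemma rho_bar_near_1:
  assumes "\<epsilon> > 0"
  obtains \<eta> where "\<eta> > 0" "\<And>p r T. \<lbrakk>p \<in> {0..1}; r \<in> {0..1}; T > 0; real T * p + (1 - r) ^ T \<le> \<eta>\<rbrakk>
    \<Longrightarrow> rho_bar p r \<ge> 1 - \<epsilon>"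
proof -
  \<comment> \<open>The solution of \<open>x / (1 - x) = \<epsilon>\<close>.\<close>
  define x where "x = \<epsilon> / (1 + \<epsilon>)"
  have x: "0 < x" "x < 1" "x / (1 - x) = \<epsilon>"
    using assms by (auto simp: x_def field_simps)
  show ?thesis
  proof (rule that[of "x / 6912"])
    fix p r and T :: nat
    assume "p \<in> {0..1}" "r \<in> {0..1}" "T > 0" "real T * p + (1 - r) ^ T \<le> x / 6912"
    then show "rho_bar p r \<ge> 1 - \<epsilon>"
      using rho_bar_ge[of p r T x] x by simp
  qed (use x in simp)
qed

lemma rho_bar_le_1: "rho_bar p r \<le> 1"
  unfolding rho_bar_def by (rule prob_space.prob_le_1[OF prob_space_mu_field])

theorem theorem3:
  shows "(\<forall>r. 0 < r \<and> r \<le> 1 \<longrightarrow> ((\<lambda>p. rho_bar p r) \<longlongrightarrow> 1) (at_right 0))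
     \<and> (\<exists>c>0. \<forall>\<epsilon>>0. \<exists>\<delta>>0. \<forall>r p. 0 < r \<and> r < \<delta> \<and> 0 \<le> p \<and> p \<le> c * r\<^sup>2
            \<longrightarrow> rho_bar p r \<ge> 1 - \<epsilon>)"
proof (intro conjI allI impI)
  fix r :: real
  assume r: "0 < r \<and> r \<le> 1"
  show "((\<lambda>p. rho_bar p r) \<longlongrightarrow> 1) (at_right 0)"
  proof (rule tendstoI)
    fix e :: real assume "e > 0"
    then obtain \<eta> where \<eta>: "\<eta> > 0" "\<And>p r T. \<lbrakk>p \<in> {0..1}; r \<in> {0..1}; T > 0; real T * p + (1 - r) ^ T \<le> \<eta>\<rbrakk>
      \<Longrightarrow> rho_bar p r \<ge> 1 - e / 2"
      using rho_bar_near_1[of "e / 2"] by auto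
    obtain N where N: "(1 - r) ^ N < \<eta> / 2"
      using real_arch_pow_inv[of "\<eta> / 2" "1 - r"] r \<eta>(1) by auto
    \<comment> \<open>\<open>N\<close> may be 0, whereas \<open>Suc N\<close> is a valid block
      length. It is fixed before \<open>p\<close>, which is then taken small.\<close>
    have T: "(1 - r) ^ Suc N \<le> \<eta> / 2"
      using N r power_decreasing[of N "Suc N" "1 - r"] by linarith
    have "\<forall>\<^sub>F p in at_right 0. p \<in> {0<..<min 1 (\<eta> / (2 * real (Suc N)))}"
      using \<eta>(1) by (intro eventually_at_right_real) auto
    then show "\<forall>\<^sub>F p in at_right 0. dist (rho_bar p r) 1 < e"
    proof eventually_elim
      case (elim p)
      then have "real (Suc N) * p \<le> \<eta> / 2"
        by (simp add: field_simps)
      then have "rho_bar p r \<ge> 1 - e / 2"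
        using elim r T by (intro \<eta>(2)[of p r "Suc N"]) auto
      then show ?case
        using rho_bar_le_1[of p r] \<open>e > 0\<close> by (simp add: dist_real_def)
    qed
  qed
next
  show "\<exists>c>0. \<forall>\<epsilon>>0. \<exists>\<delta>>0. \<forall>r p. 0 < r \<and> r < \<delta> \<and> 0 \<le> p \<and> p \<le> c * r\<^sup>2
            \<longrightarrow> rho_bar p r \<ge> 1 - \<epsilon>"
  proof (rule exI[of _ 1], intro conjI allI impI)
    fix \<epsilon> :: real assume "\<epsilon> > 0"
    then obtain \<eta> where \<eta>: "\<eta> > 0" "\<And>p r T. \<lbrakk>p \<in> {0..1}; r \<in> {0..1}; T > 0; real T * p + (1 - r) ^ T \<le> \<eta>\<rbrakk>
      \<Longrightarrow> rho_bar p r \<ge> 1 - \<epsilon>"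
      using rho_bar_near_1 by blast
    \<comment> \<open>\<open>K\<close> is the lower bound sought for \<open>T * r\<close>, as
      \<open>(1 - r) ^ T \<le> exp (- (T * r))\<close>. The maximum with 1 keeps \<open>T\<close>
      positive.\<close>
    define K where "K = max 1 (ln (2 / \<eta>))"
    have K: "K \<ge> 1" "exp (- K) \<le> \<eta> / 2"
    proof -
      have "exp (- K) \<le> exp (- ln (2 / \<eta>))" by (simp add: K_def)
      then show "exp (- K) \<le> \<eta> / 2" using \<eta>(1) by (simp add: exp_minus)
    qed (simp add: K_def)
    \<comment> \<open>With \<open>T\<close> close to \<open>K / r\<close> and
      \<open>p \<le> r\<^sup>2\<close>, the product \<open>T * p\<close> is at most
      \<open>r * (K + 1)\<close>, which the second bound controls. The first gives
      \<open>r < 1\<close> and hence \<open>p \<le> 1\<close>.\<close>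
    define \<delta> where "\<delta> = min 1 (\<eta> / (2 * (K + 1)))"
    have "rho_bar p r \<ge> 1 - \<epsilon>" if h: "0 < r" "r < \<delta>" "0 \<le> p" "p \<le> r\<^sup>2" for r p
    proof -
      define T where "T = nat \<lceil>K / r\<rceil>"
      have r1: "r < 1" "r * (K + 1) \<le> \<eta> / 2"
        using h K by (auto simp: \<delta>_def field_simps)
      have T: "K / r \<le> real T" "real T \<le> K / r + 1"
        using h K by (auto simp: T_def)
      have "0 < K / r" using h K by simp
      then have "T > 0" using T(1) by linarith
      have "(1 - r) ^ T \<le> exp (- r) ^ T"
        using exp_ge_add_one_self[of "- r"] r1 by (intro power_mono) auto
      also have "\<dots> = exp (- (real T * r))" by (simp add: exp_of_nat_mult[symmetric])
      also have "\<dots> \<le> exp (- K)" using T(1) h by (simp add: field_simps)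
      finally have 1: "(1 - r) ^ T \<le> \<eta> / 2" using K by linarith
      have "real T * p \<le> (K / r + 1) * r\<^sup>2"
        using T h K by (intro mult_mono) auto
      also have "\<dots> = r * (K + r)" using h by (simp add: field_simps power2_eq_square)
      also have "\<dots> \<le> r * (K + 1)" using h r1 by (intro mult_left_mono) auto
      finally have 2: "real T * p \<le> \<eta> / 2" using r1 by linarith
      have "r\<^sup>2 \<le> 1" using h r1 by (simp add: power_le_one)
      then show ?thesis using 1 2 h r1 \<open>T > 0\<close> by (intro \<eta>(2)[of p r T]) auto
    qed
    moreover have "\<delta> > 0" using \<eta>(1) K by (simp add: \<delta>_def)
    ultimately show "\<exists>\<delta>>0. \<forall>r p. 0 < r \<and> r < \<delta> \<and> 0 \<le> p \<and> p \<le> 1 * r\<^sup>2 \<longrightarrow> rho_bar p r \<ge> 1 - \<epsilon>"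
      by auto
  qed simp
qed

end
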